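(* For every integer $r \geq 3$, there are infinitely many (pairwise non-isomorphic) connected $r$-regular permutation graphs.
   Context: All graphs are finite and simple. A graph $G$ on $n$ vertices is a permutation graph if there is a labeling $v_1, \ldots, v_n$ of its vertices and a permutation $\pi$ of $\{1,\ldots,n\}$ such that for $i<j$, the vertices $v_i$ and $v_j$ are adjacent if and only if $\pi(i) > \pi(j)$. *)

theory Defs
  imports "Graph_Theory.Digraph_Isomorphism" "HOL-Combinatorics.Permutations"
begin

text \<open>
  Finite simple graphs are represented by \<^locale>\<open>pair_graph\<close>: finite, loop-free, symmetric
  digraphs without parallel arcs. An undirected edge between \<open>u\<close> and \<open>v\<close> is the pair of arcs
  \<open>(u, v)\<close> and \<open>(v, u)\<close>.
\<close>

definition permutation_graph :: "'a pair_pre_digraph \<Rightarrow> bool" where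
  "permutation_graph G \<longleftrightarrow> pair_graph G \<and>
    (\<exists>(v :: nat \<Rightarrow> 'a) (\<pi> :: nat \<Rightarrow> nat).
      bij_betw v {1..card (pverts G)} (pverts G) \<and>
      \<pi> permutes {1..card (pverts G)} \<and>
      (\<forall>i \<in> {1..card (pverts G)}. \<forall>j \<in> {1..card (pverts G)}.
        i < j \<longrightarrow> ((v i, v j) \<in> parcs G \<longleftrightarrow> \<pi> i > \<pi> j)))"

text \<open>In a symmetric digraph without parallel arcs the out-degree of a vertex is the number of its
  neighbours, i.e. its degree in the undirected sense.\<close>

definition regular_graph :: "nat \<Rightarrow> 'a pair_pre_digraph \<Rightarrow> bool" where
  "regular_graph r G \<longleftrightarrow> pair_graph G \<and> (\<forall>u \<in> pverts G. out_degree (with_proj G) u = r)"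

end

theory Submission
  imports Defs
begin

text \<open>
  Substituting independent sets or perfect matchings for the vertices of a path yields a permutation
  graph. Replace the vertices of a path on \<open>n\<close> vertices by bags of sizes \<open>a 0, \<dots>, a (n - 1)\<close>,
  independent except that the first and the last bag carry a perfect matching, and join consecutive
  bags completely. The result is \<open>r\<close>-regular if \<open>a (i - 1) + a (i + 1) = r\<close> at every
  inner bag and \<open>a 1 = a (n - 2) = r - 1\<close>. The periodic size sequences \<open>r - 1, r - 1, 1, 1\<close>
  (for odd \<open>r\<close>, stopped after the second term of a period) and \<open>2, r - 1, r - 2, 1\<close> (for even \<open>r\<close>,
  stopped after the third term) satisfy this, with both end bags of even size.
\<close>

section \<open>Permutation graphs from two linear orders\<close>

text \<open>Counting with \<open>\<le>\<close> makes the ranks of an injective key start at 1, as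
  the labels in \<open>permutation_graph\<close> do.\<close>

definition rank_in :: "'a set \<Rightarrow> ('a \<Rightarrow> nat) \<Rightarrow> 'a \<Rightarrow> nat" where
  "rank_in V f u = card {w \<in> V. f w \<le> f u}"

lemma rank_in_less:
  assumes "finite V" "u \<in> V" "v \<in> V" "f u < f v"
  shows "rank_in V f u < rank_in V f v"
proof -
  have "v \<in> {w \<in> V. f w \<le> f v} - {w \<in> V. f w \<le> f u}" using assms by simp
  moreover have "{w \<in> V. f w \<le> f u} \<subseteq> {w \<in> V. f w \<le> f v}" using assms by auto
  ultimately show ?thesis
    unfolding rank_in_def using assms(1) by (intro psubset_card_mono) auto
qed

lemma rank_in_less_iff:
  assumes "finite V" "inj_on f V" "u \<in> V" "v \<in> V"
  shows "rank_in V f u < rank_in V f v \<longleftrightarrow> f u < f v"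
proof (cases "f u" "f v" rule: linorder_cases)
  case less
  then show ?thesis using rank_in_less[OF assms(1,3,4)] by simp
next
  case equal
  then show ?thesis by (simp add: rank_in_def)
next
  case greater
  then show ?thesis using rank_in_less[OF assms(1,4,3), of f] by simp
qed

lemma bij_betw_rank_in:
  assumes "finite V" "inj_on f V"
  shows "bij_betw (rank_in V f) V {1..card V}"
proof -
  have inj: "inj_on (rank_in V f) V"
  proof (rule inj_onI)
    fix u v assume uv: "u \<in> V" "v \<in> V" "rank_in V f u = rank_in V f v"
    then have "f u = f v"
      using rank_in_less[OF assms(1), of u v f] rank_in_less[OF assms(1), of v u f]
      by (metis less_irrefl linorder_neqE_nat)
    then show "u = v" using uv assms(2) by (auto dest: inj_onD)
  qed
  have "rank_in V f ` V \<subseteq> {1..card V}"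
  proof
    fix x assume "x \<in> rank_in V f ` V"
    then obtain u where u: "u \<in> V" "x = rank_in V f u" by blast
    have "x \<le> card V" unfolding u rank_in_def using assms(1) by (intro card_mono) auto
    moreover have "x > 0" unfolding u rank_in_def using assms(1) u by (auto simp: card_gt_0_iff)
    ultimately show "x \<in> {1..card V}" by simp
  qed
  then have "rank_in V f ` V = {1..card V}"
    by (intro card_subset_eq) (simp_all add: card_image[OF inj])
  with inj show ?thesis by (simp add: bij_betw_def)
qed

text \<open>Label the vertices in the order of \<open>f\<close> and let the permutation send each
  \<open>f\<close>-rank to the \<open>g\<close>-rank of the same vertex: its inversions are the
  pairs that \<open>f\<close> and \<open>g\<close> order oppositely. Only two injective keys then
  have to be found.\<close>

lemma permutation_graphI:
  fixes G :: "'a pair_pre_digraph" and f g :: "'a \<Rightarrow> nat"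
  assumes G: "pair_graph G"
    and f: "inj_on f (pverts G)" and g: "inj_on g (pverts G)"
    and arcs: "\<And>u v. u \<in> pverts G \<Longrightarrow> v \<in> pverts G \<Longrightarrow> f u < f v \<Longrightarrow>
      (u, v) \<in> parcs G \<longleftrightarrow> g v < g u"
  shows "permutation_graph G"
proof -
  let ?V = "pverts G" and ?n = "card (pverts G)"
  interpret pair_graph G by (fact G)
  have fin: "finite ?V" by (rule pair_finite_verts)
  define v where "v = inv_into ?V (rank_in ?V f)"
  \<comment> \<open>The identity outside the label range is what \<open>permutes\<close>
    demands.\<close>
  define \<pi> where "\<pi> i = (if i \<in> {1..?n} then rank_in ?V g (v i) else i)" for i
  have v: "bij_betw v {1..?n} ?V"
    unfolding v_def by (intro bij_betw_inv_into bij_betw_rank_in fin f)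
  have rank_v: "rank_in ?V f (v i) = i" if "i \<in> {1..?n}" for i
    unfolding v_def using that bij_betw_rank_in[OF fin f] by (simp add: bij_betw_inv_into_right)
  have "bij_betw (rank_in ?V g \<circ> v) {1..?n} {1..?n}"
    by (rule bij_betw_trans[OF v bij_betw_rank_in[OF fin g]])
  then have "bij_betw \<pi> {1..?n} {1..?n}"
    by (rule iffD1[OF bij_betw_cong, rotated]) (auto simp: \<pi>_def)
  then have "\<pi> permutes {1..?n}"
    by (rule bij_imp_permutes) (simp only: \<pi>_def if_False)
  moreover have "(v i, v j) \<in> parcs G \<longleftrightarrow> \<pi> i > \<pi> j"
    if ij: "i \<in> {1..?n}" "j \<in> {1..?n}" "i < j" for i j
  proof -
    have mem: "v i \<in> ?V" "v j \<in> ?V" using v ij by (auto simp: bij_betw_def)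
    have "f (v i) < f (v j)"
      using rank_in_less_iff[OF fin f mem] rank_v ij by simp
    then have "(v i, v j) \<in> parcs G \<longleftrightarrow> g (v j) < g (v i)" using arcs mem by blast
    also have "\<dots> \<longleftrightarrow> rank_in ?V g (v j) < rank_in ?V g (v i)"
      using rank_in_less_iff[OF fin g mem(2,1)] by simp
    finally show ?thesis using ij by (simp add: \<pi>_def)
  qed
  ultimately show ?thesis unfolding permutation_graph_def using G v by blast
qed

section \<open>Lexicographic keys, the matching and the path\<close>

text \<open>With \<open>k\<close> and \<open>l\<close> below \<open>r\<close>, the sums behave like
  two-digit numbers in base \<open>r\<close>, so one natural number encodes a lexicographic
  key.\<close>

lemma lex_less_iff:
  fixes x y k l r :: nat
  assumes "k < r" "l < r"
  shows "x * r + k < y * r + l \<longleftrightarrow> x < y \<or> x = y \<and> k < l"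
proof (cases x y rule: linorder_cases)
  case less
  then have "Suc x * r \<le> y * r" by (intro mult_right_mono) auto
  with less assms show ?thesis by simp
next
  case greater
  then have "Suc y * r \<le> x * r" by (intro mult_right_mono) auto
  with greater assms show ?thesis by simp
qed simp

lemma lex_eq_iff:
  fixes x y k l r :: nat
  assumes "k < r" "l < r"
  shows "x * r + k = y * r + l \<longleftrightarrow> x = y \<and> k = l"
  using lex_less_iff[OF assms, of x y] lex_less_iff[OF assms(2,1), of y x]
  by (metis less_irrefl linorder_neqE_nat)

text \<open>The perfect matching 0-1, 2-3, 4-5, and so on, as a fixed-point-free involution.\<close>

definition swap_pair :: "nat \<Rightarrow> nat" where
  "swap_pair k = (if even k then Suc k else k - 1)"

text \<open>An initial segment of even length is a union of whole pairs; this is why the end bags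
  must have even size.\<close>

lemma swap_pair_less: "even m \<Longrightarrow> k < m \<Longrightarrow> swap_pair k < m"
  unfolding swap_pair_def by (auto, presburger)

lemma swap_pair_swap_pair [simp]: "swap_pair (swap_pair k) = k"
  by (auto simp: swap_pair_def)

lemma swap_pair_neq [simp]: "swap_pair k \<noteq> k"
  by (cases k) (auto simp: swap_pair_def)

text \<open>The swap keeps the order of distinct pairs and reverses each pair, so its inversion
  graph is the matching.\<close>

lemma swap_pair_inversion_iff: "k < l \<Longrightarrow> swap_pair l < swap_pair k \<longleftrightarrow> l = swap_pair k"
  unfolding swap_pair_def by (auto split: if_splits; presburger)

text \<open>The pair \<open>order1\<close>, \<open>order2\<close> realises the infinite path as an inversion graph: each order moves
  one parity class past exactly one neighbour.\<close>

definition order1 :: "nat \<Rightarrow> nat" where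
  "order1 i = 2 * i + (if odd i then 3 else 0)"

definition order2 :: "nat \<Rightarrow> nat" where
  "order2 i = 2 * i + (if even i then 3 else 0)"

lemma order1_eq_iff: "order1 i = order1 j \<longleftrightarrow> i = j"
  unfolding order1_def by (auto split: if_splits; presburger)

lemma order2_eq_iff: "order2 i = order2 j \<longleftrightarrow> i = j"
  unfolding order2_def by (auto split: if_splits; presburger)

text \<open>Indices of equal parity are shifted alike. For opposite parity the unshifted values
  differ by 2 at neighbours and by at least 6 otherwise, so the shift by 3 reverses exactly the
  neighbours, each pair in one of the two orders.\<close>

lemma order_inversion_iff:
  "order1 i < order1 j \<Longrightarrow> order2 j < order2 i \<longleftrightarrow> j = Suc i \<or> i = Suc j"
  unfolding order1_def order2_def by (auto split: if_splits; presburger)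

section \<open>The bag graph\<close>

text \<open>Position \<open>k\<close> of bag \<open>i\<close> is the vertex \<open>i * r + k\<close>; every bag has fewer than \<open>r\<close> elements.\<close>

locale bag_path =
  fixes r n :: nat and a :: "nat \<Rightarrow> nat"
  assumes n_ge_2: "2 \<le> n"
    and bag_pos: "0 < a i"
    and bag_sum: "a i + a (Suc (Suc i)) = r"
    and second: "Suc (a 1) = r" "Suc (a (n - 2)) = r"
    and even_ends: "even (a 0)" "even (a (n - 1))"
begin

definition is_end :: "nat \<Rightarrow> bool" where
  "is_end i \<longleftrightarrow> i = 0 \<or> i = n - 1"

definition V :: "nat set" where
  "V = {u. u div r < n \<and> u mod r < a (u div r)}"

definition adj :: "nat \<Rightarrow> nat \<Rightarrow> bool" where
  "adj u v \<longleftrightarrow> v div r = Suc (u div r) \<or> u div r = Suc (v div r) \<or>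
    u div r = v div r \<and> is_end (u div r) \<and> v mod r = swap_pair (u mod r)"

definition G :: "nat pair_pre_digraph" where
  "G = \<lparr>pverts = V, parcs = {(u, v). u \<in> V \<and> v \<in> V \<and> adj u v}\<rparr>"

definition bag :: "nat \<Rightarrow> nat set" where
  "bag i = (\<lambda>k. i * r + k) ` {..<a i}"

text \<open>The sum condition runs along the infinite sequence \<open>a\<close>, also beyond
  \<open>n\<close>, so a positive term two steps further bounds even the last bags.\<close>

lemma bag_less: "a i < r"
  using bag_sum[of i] bag_pos[of "Suc (Suc i)"] by simp

lemma r_pos: "0 < r"
  using bag_less[of 0] by simp

lemma bag_eq: "bag i = {u. u div r = i \<and> u mod r < a i}"
proof (intro set_eqI iffI)
  fix u assume "u \<in> bag i"
  then show "u \<in> {u. u div r = i \<and> u mod r < a i}"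
    using bag_less[of i] by (auto simp: bag_def)
next
  fix u assume u: "u \<in> {u. u div r = i \<and> u mod r < a i}"
  then have "u = i * r + u mod r" using div_mult_mod_eq[of u r] by simp
  then show "u \<in> bag i" unfolding bag_def using u by blast
qed

lemma card_bag: "card (bag i) = a i"
  unfolding bag_def by (subst card_image) (auto simp: inj_on_def)

lemma finite_bag: "finite (bag i)"
  by (simp add: bag_def)

lemma V_eq: "V = (\<Union>i<n. bag i)"
  by (auto simp: V_def bag_eq)

lemma finite_V: "finite V"
  by (simp add: V_eq finite_bag)

lemma adj_sym: "adj u v \<Longrightarrow> adj v u"
  by (auto simp: adj_def)

lemma pair_graph_G: "pair_graph G"
proof unfold_locales
  have "parcs G \<subseteq> V \<times> V" by (auto simp: G_def)
  then show "finite (parcs G)" by (rule finite_subset) (simp add: finite_V)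
  show "symmetric (with_proj G)"
    by (auto simp: symmetric_def G_def intro!: symI adj_sym)
  show "fst e \<noteq> snd e" if "e \<in> parcs G" for e
    using that swap_pair_neq[symmetric] by (auto simp: G_def adj_def)
qed (auto simp: G_def finite_V)

lemma swap_pair_less_bag:
  assumes "is_end i" "k < a i"
  shows "swap_pair k < a i"
  using assms even_ends by (intro swap_pair_less) (auto simp: is_end_def)

section \<open>Two orders realising the bag graph\<close>

text \<open>The position used by the second order: matched pairs of an end bag are reversed, while
  inner bags keep their order and so stay independent.\<close>

definition twist :: "nat \<Rightarrow> nat" where
  "twist u = (if is_end (u div r) then swap_pair (u mod r) else u mod r)"

lemma twist_less: "u \<in> V \<Longrightarrow> twist u < r"
  using swap_pair_less_bag bag_less less_trans
  by (fastforce simp: twist_def V_def)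

definition f :: "nat \<Rightarrow> nat" where
  "f u = order1 (u div r) * r + u mod r"

definition g :: "nat \<Rightarrow> nat" where
  "g u = order2 (u div r) * r + twist u"

lemma inj_f: "inj_on f V"
proof (rule inj_onI)
  fix u v assume "f u = f v"
  then have "u div r = v div r \<and> u mod r = v mod r"
    unfolding f_def using r_pos by (simp add: lex_eq_iff order1_eq_iff)
  then show "u = v" by (metis div_mult_mod_eq)
qed

lemma inj_g: "inj_on g V"
proof (rule inj_onI)
  fix u v assume "u \<in> V" "v \<in> V" "g u = g v"
  then have "u div r = v div r \<and> twist u = twist v"
    unfolding g_def by (simp add: lex_eq_iff twist_less order2_eq_iff)
  then have "u div r = v div r \<and> u mod r = v mod r"
    by (auto simp: twist_def split: if_splits) (metis swap_pair_swap_pair)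
  then show "u = v" by (metis div_mult_mod_eq)
qed

text \<open>Across bags, \<open>order1\<close> and \<open>order2\<close> decide and disagree exactly
  at consecutive bags. Within a bag the positions decide, and \<open>twist\<close> inverts exactly
  the matched pairs of the end bags.\<close>

lemma adj_iff_inversion:
  assumes "u \<in> V" "v \<in> V" "f u < f v"
  shows "adj u v \<longleftrightarrow> g v < g u"
proof -
  have g: "g v < g u \<longleftrightarrow> order2 (v div r) < order2 (u div r) \<or> v div r = u div r \<and> twist v < twist u"
    unfolding g_def using assms by (simp add: lex_less_iff twist_less order2_eq_iff)
  have "order1 (u div r) < order1 (v div r) \<or> u div r = v div r \<and> u mod r < v mod r"
    using assms(3) r_pos unfolding f_def by (simp add: lex_less_iff order1_eq_iff)
  then show ?thesis
  proof
    assume less: "order1 (u div r) < order1 (v div r)"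
    then have "u div r \<noteq> v div r" by auto
    then show ?thesis using order_inversion_iff[OF less] unfolding g adj_def by auto
  next
    assume "u div r = v div r \<and> u mod r < v mod r"
    then show ?thesis using swap_pair_inversion_iff[of "u mod r" "v mod r"]
      unfolding g adj_def twist_def by auto
  qed
qed

lemma permutation_graph_G: "permutation_graph G"
  using pair_graph_G
  by (rule permutation_graphI[where f = f and g = g])
    (auto simp: G_def inj_f inj_g adj_iff_inversion)

section \<open>Regularity\<close>

text \<open>An inner vertex sees the two bags beside its own, of total size \<open>r\<close> by
  \<open>bag_sum\<close>. A vertex of an end bag sees one bag of size \<open>r - 1\<close> and its
  matching partner.\<close>

lemma card_neighbours:
  assumes u: "u \<in> V"
  shows "card {v \<in> V. adj u v} = r"
proof -
  define i k where "i = u div r" and "k = u mod r"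
  have i: "i < n" and k: "k < a i" using u by (auto simp: V_def i_def k_def)
  have partner: "i * r + swap_pair k \<in> bag i" if "is_end i"
    using swap_pair_less_bag[OF that k] by (auto simp: bag_def)
  have nb: "{v \<in> V. adj u v} = (\<Union>j \<in> {j. j < n \<and> (j = Suc i \<or> i = Suc j)}. bag j)
      \<union> (if is_end i then {i * r + swap_pair k} else {})" (is "?N = ?B \<union> ?E")
  proof (intro set_eqI iffI)
    fix v assume v: "v \<in> ?N"
    then have *: "v \<in> bag (v div r)" "v div r < n" "v = (v div r) * r + v mod r"
      by (auto simp: V_def bag_eq)
    from v show "v \<in> ?B \<union> ?E" unfolding mem_Collect_eq adj_def i_def[symmetric] k_def[symmetric]
      using * by fastforce
  next
    fix v assume v: "v \<in> ?B \<union> ?E"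
    show "v \<in> ?N"
    proof (cases "v \<in> ?B")
      case True
      then show ?thesis by (auto simp: V_def bag_eq adj_def i_def)
    next
      case False
      with v have e: "is_end i" "v = i * r + swap_pair k" by (auto split: if_splits)
      then have "swap_pair k < r" using swap_pair_less_bag[OF _ k] bag_less less_trans by blast
      then have "v div r = i" "v mod r = swap_pair k" using e by auto
      then show ?thesis using e swap_pair_less_bag[OF _ k] i
        by (auto simp: V_def adj_def i_def k_def)
    qed
  qed
  consider "i = 0" | "i = n - 1" "i > 0" | "0 < i" "i < n - 1" using i by linarith
  then show ?thesis
  proof cases
    case 1
    then have "{j. j < n \<and> (j = Suc i \<or> i = Suc j)} = {1}" using n_ge_2 by auto
    \<comment> \<open>For \<open>i = 0\<close> the partner is the vertex \<open>swap_pair k\<close>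
      itself. It lies in bag 0, so it is counted in addition to bag 1.\<close>
    moreover have "swap_pair k \<notin> bag 1"
      using partner 1 by (auto simp: bag_eq is_end_def)
    ultimately show ?thesis
      unfolding nb using 1 second(1) by (simp add: is_end_def finite_bag card_bag)
  next
    case 2
    then have "{j. j < n \<and> (j = Suc i \<or> i = Suc j)} = {n - 2}" using n_ge_2 by auto
    moreover have "i * r + swap_pair k \<notin> bag (n - 2)"
      using partner 2 by (auto simp: bag_eq is_end_def)
    ultimately show ?thesis
      unfolding nb using 2 second(2) by (simp add: is_end_def finite_bag card_bag)
  next
    case 3
    then obtain j where j: "i = Suc j" by (cases i) auto
    have "{j. j < n \<and> (j = Suc i \<or> i = Suc j)} = {j, Suc i}" using 3 j by auto
    moreover have "bag j \<inter> bag (Suc i) = {}" using j by (auto simp: bag_eq)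
    ultimately show ?thesis
      unfolding nb using 3 bag_sum[of j] j
      by (simp add: is_end_def finite_bag card_bag card_Un_disjoint)
  qed
qed

lemma regular_graph_G: "regular_graph r G"
  unfolding regular_graph_def
proof (intro conjI ballI pair_graph_G)
  fix u assume u: "u \<in> pverts G"
  have "out_arcs (with_proj G) u = Pair u ` {v \<in> V. adj u v}"
    using u by (auto simp: out_arcs_def G_def)
  then show "out_degree (with_proj G) u = r"
    using card_neighbours[of u] u by (simp add: out_degree_def card_image inj_on_def G_def)
qed

section \<open>Connectedness and number of vertices\<close>

lemma bag_start_in_V: "i < n \<Longrightarrow> i * r \<in> V"
  using bag_pos r_pos by (auto simp: V_def)

text \<open>Every vertex of bag \<open>Suc i\<close> is adjacent to the first vertex of bag
  \<open>i\<close>, so induction on the bag leads from any vertex to the vertex 0; symmetry supplies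
  the way back.\<close>

lemma connected_G: "Digraph_Component.connected (with_proj G)"
proof -
  interpret pair_graph G by (rule pair_graph_G)
  have arc: "(u, v) \<in> parcs G" if "u \<in> V" "v \<in> V" "adj u v" for u v
    using that by (simp add: G_def)
  have reach: "u \<rightarrow>\<^sup>*\<^bsub>with_proj G\<^esub> 0" if "u div r = i" "u \<in> V" for u i
    using that
  proof (induction i arbitrary: u)
    \<comment> \<open>Vertices of bag 0 need not be adjacent to 0, so the walk makes a detour
      through \<open>r\<close>, the first vertex of bag 1.\<close>
    case 0
    have "r \<in> V" "0 \<in> V" using bag_start_in_V[of 1] bag_start_in_V[of 0] n_ge_2 by auto
    moreover have "adj u r" "adj r 0" using 0 r_pos by (auto simp: adj_def)
    ultimately have step: "(u, r) \<in> parcs G" "(r, 0) \<in> parcs G" using arc 0 by auto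
    have "0 \<rightarrow>\<^sup>*\<^bsub>with_proj G\<^esub> 0" using \<open>0 \<in> V\<close> by (intro reachable_refl) (simp add: G_def)
    with step(2) have "r \<rightarrow>\<^sup>*\<^bsub>with_proj G\<^esub> 0" by (rule adj_reachable_trans)
    with step(1) show ?case by (rule adj_reachable_trans)
  next
    case (Suc i)
    then have "i < n" by (auto simp: V_def)
    moreover have "adj u (i * r)" using Suc r_pos by (auto simp: adj_def)
    ultimately have "(u, i * r) \<in> parcs G" "(i * r) \<rightarrow>\<^sup>*\<^bsub>with_proj G\<^esub> 0"
      using arc Suc bag_start_in_V[of i] r_pos by auto
    then show ?case by (rule adj_reachable_trans)
  qed
  have sym: "symmetric (with_proj G)" by (rule pair_sym_arcs)
  have "u \<rightarrow>\<^sup>*\<^bsub>with_proj G\<^esub> v" if "u \<in> V" "v \<in> V" for u v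
    using reach[OF refl that(1)] symmetric_reachable[OF sym reach[OF refl that(2)]]
    by (rule reachable_trans)
  moreover have "V \<noteq> {}" using bag_start_in_V[of 0] n_ge_2 by auto
  ultimately show ?thesis
    unfolding Digraph_Component.connected_def strongly_connected_def
    using reachable_mk_symmetric_eq[OF sym] by (auto simp: G_def)
qed

lemma card_V: "card V = (\<Sum>i<n. a i)"
proof -
  have "bag i \<inter> bag j = {}" if "i \<noteq> j" for i j using that by (auto simp: bag_eq)
  then show ?thesis unfolding V_eq by (subst card_UN_disjoint) (auto simp: finite_bag card_bag)
qed

end

section \<open>Size sequences and the infinite family\<close>

lemma digraph_iso_card_verts:
  assumes "digraph_iso G H"
  shows "card (verts G) = card (verts H)"
  using assms
  by (auto simp: digraph_iso_def app_iso_def pre_digraph.digraph_isomorphism_def card_image)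

text \<open>Terms two apart are \<open>r - 1\<close> and 1 in some order. The last two indices are 0
  and 1 modulo 4, so both bags there have size \<open>r - 1\<close>, which is even for odd
  \<open>r\<close>.\<close>

lemma bag_path_odd:
  assumes "odd r" "r \<ge> 3"
  shows "bag_path r (4 * m + 2) (\<lambda>i. if i mod 4 < 2 then r - 1 else 1)"
proof unfold_locales
  fix i :: nat
  have "Suc (Suc i) mod 4 < 2 \<longleftrightarrow> \<not> i mod 4 < 2" by presburger
  then show "(if i mod 4 < 2 then r - 1 else 1) +
      (if Suc (Suc i) mod 4 < 2 then r - 1 else 1) = r"
    using assms by auto
qed (use assms in \<open>auto simp: mod_Suc\<close>)

text \<open>For even \<open>r\<close> end bags of size \<open>r - 1\<close> would admit no perfect
  matching. Here terms two apart are 2 and \<open>r - 2\<close>, or \<open>r - 1\<close> and 1; the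
  last two indices are 1 and 2 modulo 4, giving sizes \<open>r - 1\<close> and \<open>r - 2\<close>,
  the latter even and positive.\<close>

lemma bag_path_even:
  assumes "even r" "r \<ge> 3"
  shows "bag_path r (4 * m + 3)
    (\<lambda>i. if i mod 4 = 0 then 2 else if i mod 4 = 1 then r - 1 else if i mod 4 = 2 then r - 2 else 1)"
proof unfold_locales
  fix i :: nat
  have "i mod 4 < 4" by simp
  then have "i mod 4 = 0 \<or> i mod 4 = 1 \<or> i mod 4 = 2 \<or> i mod 4 = 3" by linarith
  then show "(if i mod 4 = 0 then 2 else if i mod 4 = 1 then r - 1 else if i mod 4 = 2 then r - 2 else 1) +
      (if Suc (Suc i) mod 4 = 0 then 2 else if Suc (Suc i) mod 4 = 1 then r - 1
       else if Suc (Suc i) mod 4 = 2 then r - 2 else 1) = r"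
    using assms by (auto simp: mod_Suc)
qed (use assms in \<open>auto simp: mod_Suc\<close>)

text \<open>One sequence \<open>a\<close> is cut off at ever larger lengths. The number of vertices
  then grows strictly, which separates the isomorphism classes.\<close>

lemma infinite_family:
  fixes c :: nat
  assumes path: "\<And>m. bag_path r (4 * m + c) a"
  shows "\<exists>S :: nat pair_pre_digraph set. infinite S \<and>
    (\<forall>G \<in> S. permutation_graph G \<and> Digraph_Component.connected (with_proj G) \<and> regular_graph r G) \<and>
    pairwise (\<lambda>G H. \<not> digraph_iso (with_proj G) (with_proj H)) S"
proof -
  define H where "H m = bag_path.G r (4 * m + c) a" for m
  have card_H: "card (pverts (H m)) = (\<Sum>i<4 * m + c. a i)" for m
    using bag_path.card_V[OF path] by (simp add: H_def bag_path.G_def[OF path])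
  have "card (pverts (H m)) < card (pverts (H m'))" if "m < m'" for m m'
    unfolding card_H using that bag_path.bag_pos[OF path]
    \<comment> \<open>The index \<open>4 * m + c\<close> occurs only in the longer sum, and its bag
      is nonempty.\<close>
    by (intro sum_strict_mono2[where b = "4 * m + c"]) auto
  then have inj: "inj (\<lambda>m. card (pverts (H m)))"
    by (intro linorder_injI) (simp add: less_imp_neq)
  then have "inj H" by (auto simp: inj_def)
  then have "infinite (range H)" by (simp add: finite_image_iff)
  moreover have "pairwise (\<lambda>G H. \<not> digraph_iso (with_proj G) (with_proj H)) (range H)"
  proof (intro pairwiseI notI)
    fix X Y assume XY: "X \<in> range H" "Y \<in> range H" "X \<noteq> Y"
      and iso: "digraph_iso (with_proj X) (with_proj Y)"
    from XY obtain m m' where m: "X = H m" "Y = H m'" by blast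
    have "card (pverts (H m)) = card (pverts (H m'))"
      using digraph_iso_card_verts[OF iso] by (simp add: m)
    with inj have "m = m'" by (rule injD)
    with XY m show False by simp
  qed
  moreover have "permutation_graph (H m) \<and> Digraph_Component.connected (with_proj (H m)) \<and>
      regular_graph r (H m)" for m
    unfolding H_def using bag_path.permutation_graph_G[OF path] bag_path.connected_G[OF path]
      bag_path.regular_graph_G[OF path] by blast
  ultimately show ?thesis by (intro exI[of _ "range H"]) auto
qed

theorem theorem1p1:
  fixes r :: nat
  assumes "r \<ge> 3"
  shows "\<exists>S :: nat pair_pre_digraph set. infinite S \<and>
    (\<forall>G \<in> S. permutation_graph G \<and> Digraph_Component.connected (with_proj G) \<and> regular_graph r G) \<and>
    pairwise (\<lambda>G H. \<not> digraph_iso (with_proj G) (with_proj H)) S"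
proof (cases "even r")
  case True
  show ?thesis by (rule infinite_family[OF bag_path_even[OF True assms]])
next
  case False
  show ?thesis by (rule infinite_family[OF bag_path_odd[OF False assms]])
qed

end
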